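(* Let $n,m\ge 0$ be integers with $2n+m\ge 1$ and $(n,m)\neq(0,1)$. Let $G$ be a simple graph with $\chi_{n,m}(G)=k$ and $k\ge 4$. Then $$\chi_a(G)\le k^2+k^{2+\lceil \log_{2n+m}\log_{2n+m} k\rceil}.$$
   Context: All graphs are finite. An $(n,m)$-graph $G$ is a graph with $n$ types of arcs (labeled $2,4,\ldots,2n$) and $m$ types of edges (labeled $2n+1,\ldots,2n+m$), whose underlying undirected graph $\mathrm{und}(G)$ is simple (so each adjacent pair of distinct vertices is joined by exactly one arc or exactly one edge, with exactly one type, and there are no loops). A homomorphism of an $(n,m)$-graph $G$ to an $(n,m)$-graph $H$ is a map $f:V(G)\to V(H)$ such that whenever $uv$ is an arc from $u$ to $v$ (resp. an edge) of type $\alpha$ in $G$, $f(u)f(v)$ is an arc from $f(u)$ to $f(v)$ (resp. an edge) of type $\alpha$ in $H$; write $G\to H$ if one exists. For an $(n,m)$-graph $G$, $\chi_{n,m}(G)=\min\{|V(H)|: H \text{ an } (n,m)\text{-graph},\ G\to H\}$. For a simple graph $S$, $\chi_{n,m}(S)=\max\{\chi_{n,m}(G): G \text{ an } (n,m)\text{-graph with } \mathrm{und}(G)=S\}$. An acyclic $s$-coloring of $G$ is a proper vertex coloring with $s$ colors in which the subgraph induced by any two color classes is a forest; the acyclic chromatic number $\chi_a(G)$ is the minimum $s$ such that $G$ admits an acyclic $s$-coloring. *)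

theory Defs
  imports Complex_Main "HOL-Library.FuncSet" "Graph_Theory.Graph_Theory"
begin

section \<open>\<open>(n,m)\<close>-graphs and their chromatic number\<close>

text \<open>
  A finite simple graph is a \<^locale>\<open>pair_graph\<close>: an undirected edge is stored as the two
  ordered pairs of its endpoints.
  In an \<open>(n,m)\<close>-graph, \<open>adj G t\<close> is the set of pairs \<open>(u,v)\<close> such that \<open>uv\<close> is an arc
  from \<open>u\<close> to \<open>v\<close> of type \<open>t\<close>, or an edge of type \<open>t\<close>; as in \<^locale>\<open>pair_graph\<close>,
  an edge contributes both \<open>(u,v)\<close> and \<open>(v,u)\<close>.
\<close>

record 'a nm_pre_graph =
  nm_verts :: "'a set"
  adj :: "nat \<Rightarrow> 'a rel"

definition arc_types :: "nat \<Rightarrow> nat set" where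
  "arc_types n = (\<lambda>i. 2 * i) ` {1..n}"

definition edge_types :: "nat \<Rightarrow> nat \<Rightarrow> nat set" where
  "edge_types n m = {2 * n + 1..2 * n + m}"

text \<open>
  The conditions \<open>adj_irrefl\<close>, \<open>arc_asym\<close> and \<open>adj_type_unique\<close> say that the underlying
  graph is simple: there are no loops, and any two adjacent vertices are joined by exactly one
  arc or exactly one edge, of one type.
\<close>

locale nm_graph =
  fixes n m :: nat and G :: "'a nm_pre_graph"
  assumes finite_nm_verts: "finite (nm_verts G)"
    and adj_verts: "adj G t \<subseteq> nm_verts G \<times> nm_verts G"
    and adj_types: "t \<notin> arc_types n \<union> edge_types n m \<Longrightarrow> adj G t = {}"
    and adj_irrefl: "(v, v) \<notin> adj G t"
    and arc_asym: "t \<in> arc_types n \<Longrightarrow> (u, v) \<in> adj G t \<Longrightarrow> (v, u) \<notin> adj G t'"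
    and edge_sym: "t \<in> edge_types n m \<Longrightarrow> sym (adj G t)"
    and adj_type_unique: "(u, v) \<in> adj G t \<Longrightarrow> (u, v) \<in> adj G t' \<Longrightarrow> t = t'"

definition und :: "'a nm_pre_graph \<Rightarrow> 'a pair_pre_digraph" where
  "und G = \<lparr> pverts = nm_verts G, parcs = (\<Union>t. adj G t \<union> (adj G t)\<inverse>) \<rparr>"

definition nm_hom :: "'a nm_pre_graph \<Rightarrow> 'b nm_pre_graph \<Rightarrow> ('a \<Rightarrow> 'b) \<Rightarrow> bool" where
  "nm_hom G H f \<longleftrightarrow> f \<in> nm_verts G \<rightarrow> nm_verts H \<and>
     (\<forall>t u v. (u, v) \<in> adj G t \<longrightarrow> (f u, f v) \<in> adj H t)"

text \<open>
  Every finite target graph is isomorphic to one whose vertices are natural numbers, so the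
  minimum may be taken over these; see \<open>nm_chromatic_le\<close> below.
\<close>

definition nm_chromatic :: "nat \<Rightarrow> nat \<Rightarrow> 'a nm_pre_graph \<Rightarrow> nat" where
  "nm_chromatic n m G =
     (LEAST c. \<exists>H :: nat nm_pre_graph. nm_graph n m H \<and> (\<exists>f. nm_hom G H f) \<and> card (nm_verts H) = c)"

definition nm_chromatic_simple :: "nat \<Rightarrow> nat \<Rightarrow> 'a pair_pre_digraph \<Rightarrow> nat" where
  "nm_chromatic_simple n m S = Max {nm_chromatic n m G | G. nm_graph n m G \<and> und G = S}"


section \<open>Acyclic colorings\<close>

text \<open>
  The predicate \<^const>\<open>forest\<close> forbids all directed cycles and so fails for every symmetric
  digraph with an arc, since \<open>(u,v)\<close>, \<open>(v,u)\<close> is one. The cycles of the undirected graph are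
  the directed cycles of length at least 3.
\<close>

definition undirected_forest :: "('a, 'b) pre_digraph \<Rightarrow> bool" where
  "undirected_forest G \<longleftrightarrow> \<not> (\<exists>p. pre_digraph.cycle G p \<and> 3 \<le> length p)"

definition acyclic_coloring :: "'a pair_pre_digraph \<Rightarrow> nat \<Rightarrow> ('a \<Rightarrow> nat) \<Rightarrow> bool" where
  "acyclic_coloring G s c \<longleftrightarrow> c \<in> pverts G \<rightarrow> {..<s} \<and>
     (\<forall>(u, v) \<in> parcs G. c u \<noteq> c v) \<and>
     (\<forall>i < s. \<forall>j < s. i \<noteq> j \<longrightarrow>
        undirected_forest (with_proj G \<restriction> {v \<in> pverts G. c v = i \<or> c v = j}))"

definition acyclic_chromatic :: "'a pair_pre_digraph \<Rightarrow> nat" where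
  "acyclic_chromatic G = (LEAST s. \<exists>c. acyclic_coloring G s c)"


section \<open>The minimum and the maximum are attained\<close>

lemma nm_chromatic_le:
  fixes G :: "'a nm_pre_graph" and H :: "'b nm_pre_graph"
  assumes H: "nm_graph n m H" and f: "nm_hom G H f"
  shows "nm_chromatic n m G \<le> card (nm_verts H)"
proof -
  interpret H: nm_graph n m H by (rule H)
  obtain g :: "'b \<Rightarrow> nat" where g: "inj_on g (nm_verts H)"
    using finite_imp_inj_to_nat_seg[OF H.finite_nm_verts] by blast
  define K where "K = \<lparr> nm_verts = g ` nm_verts H, adj = (\<lambda>t. map_prod g g ` adj H t) \<rparr>"
  have mem: "u \<in> nm_verts H" "v \<in> nm_verts H" if "(u, v) \<in> adj H t" for u v t
    using that H.adj_verts[of t] by blast+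
  have adjK: "x \<in> adj K t \<longleftrightarrow> (\<exists>u v. x = (g u, g v) \<and> (u, v) \<in> adj H t)" for x t
    by (auto simp: K_def)
  have g_eq: "u = u'" if "g u = g u'" "u \<in> nm_verts H" "u' \<in> nm_verts H" for u u'
    using inj_onD[OF g] that by blast
  have "nm_graph n m K"
  proof
    show "finite (nm_verts K)" using H.finite_nm_verts by (simp add: K_def)
    show "adj K t \<subseteq> nm_verts K \<times> nm_verts K" for t
      using H.adj_verts[of t] by (auto simp: K_def)
    show "adj K t = {}" if "t \<notin> arc_types n \<union> edge_types n m" for t
      using H.adj_types[OF that] by (simp add: K_def)
    show "(v, v) \<notin> adj K t" for v t
      unfolding adjK using g_eq mem[of _ _ t] H.adj_irrefl by (metis Pair_inject)
    show "(v, u) \<notin> adj K t'" if "t \<in> arc_types n" "(u, v) \<in> adj K t" for t t' u v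
    proof
      assume "(v, u) \<in> adj K t'"
      then obtain a b where ab: "v = g a" "u = g b" "(a, b) \<in> adj H t'" by (auto simp: adjK)
      from that(2) obtain a' b' where "u = g b'" "v = g a'" "(b', a') \<in> adj H t"
        by (auto simp: adjK)
      then have "(b, a) \<in> adj H t" using ab mem g_eq by metis
      then show False using H.arc_asym[OF that(1)] ab(3) by blast
    qed
    show "sym (adj K t)" if "t \<in> edge_types n m" for t
    proof (rule symI)
      fix x y assume "(x, y) \<in> adj K t"
      then show "(y, x) \<in> adj K t" unfolding adjK using symD[OF H.edge_sym[OF that]] by blast
    qed
    show "t = t'" if "(u, v) \<in> adj K t" "(u, v) \<in> adj K t'" for u v t t'
    proof -
      from that(1) obtain a b where ab: "u = g a" "v = g b" "(a, b) \<in> adj H t"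
        by (auto simp: adjK)
      from that(2) obtain a' b' where "u = g a'" "v = g b'" "(a', b') \<in> adj H t'"
        by (auto simp: adjK)
      then have "(a, b) \<in> adj H t'" using ab mem g_eq by metis
      with ab(3) show ?thesis by (rule H.adj_type_unique)
    qed
  qed
  moreover have "nm_hom G K (g \<circ> f)"
    using f unfolding nm_hom_def K_def by (auto intro!: image_eqI map_prod_imageI)
  moreover have "card (nm_verts K) = card (nm_verts H)"
    using g by (simp add: K_def card_image)
  ultimately show ?thesis
    unfolding nm_chromatic_def by (intro Least_le) blast
qed

lemma finite_nm_chromatic_values: "finite {nm_chromatic n m G | G. nm_graph n m G \<and> und G = S}"
proof (rule finite_subset)
  have "nm_chromatic n m G \<le> card (pverts (und G))" if "nm_graph n m G" for G :: "'a nm_pre_graph"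
    using nm_chromatic_le[OF that, of G id] by (simp add: nm_hom_def und_def)
  then show "{nm_chromatic n m G | G. nm_graph n m G \<and> und G = S} \<subseteq> {..card (pverts S)}"
    by auto
qed simp

lemma nm_chromatic_values_nonempty:
  fixes S :: "'a pair_pre_digraph"
  assumes "pair_graph S" and "1 \<le> 2 * n + m"
  shows "{nm_chromatic n m G | G. nm_graph n m G \<and> und G = S} \<noteq> {}"
proof -
  interpret pair_graph S by (rule assms)
  have symS: "(v, u) \<in> parcs S" if "(u, v) \<in> parcs S" for u v
    using that pair_sym_arcs by (auto simp: symmetric_def sym_def)
  have inV: "u \<in> pverts S" "v \<in> pverts S" if "(u, v) \<in> parcs S" for u v
    using arc_fst_in_verts[OF that] arc_snd_in_verts[OF that] by simp_all
  obtain h :: "'a \<Rightarrow> nat" where h: "inj_on h (pverts S)"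
    using finite_imp_inj_to_nat_seg[OF pair_finite_verts] by blast
  define R where "R = (if 1 \<le> n then {(u, v) \<in> parcs S. h u < h v} else parcs S)"
  define r where "r = (if 1 \<le> n then 2 else 2 * n + 1)"
  define G where "G = \<lparr> nm_verts = pverts S, adj = (\<lambda>t. if t = r then R else {}) \<rparr>"
  have r: "r \<in> arc_types n \<longleftrightarrow> 1 \<le> n" "r \<in> edge_types n m \<longleftrightarrow> \<not> 1 \<le> n"
    using assms(2) by (auto simp: r_def arc_types_def edge_types_def image_iff)
  have G: "nm_graph n m G"
  proof
    show "finite (nm_verts G)" by (simp add: G_def)
    show "adj G t \<subseteq> nm_verts G \<times> nm_verts G" for t
      by (auto simp: G_def R_def dest: inV split: if_splits)
    show "adj G t = {}" if "t \<notin> arc_types n \<union> edge_types n m" for t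
      using that r by (auto simp: G_def)
    show "(v, v) \<notin> adj G t" for v t
      using pair_no_loops[of "(v, v)"] by (auto simp: G_def R_def)
    show "(v, u) \<notin> adj G t'" if "t \<in> arc_types n" "(u, v) \<in> adj G t" for t t' u v
      using that r by (auto simp: G_def R_def split: if_splits)
    show "sym (adj G t)" if "t \<in> edge_types n m" for t
      using that r symS by (auto simp: G_def R_def sym_def)
    show "t = t'" if "(u, v) \<in> adj G t" "(u, v) \<in> adj G t'" for u v t t'
      using that by (auto simp: G_def split: if_splits)
  qed
  have RS: "R \<union> R\<inverse> = parcs S"
  proof -
    have "h u \<noteq> h v" if "(u, v) \<in> parcs S" for u v
    proof
      assume "h u = h v"
      then have "u = v" using inj_onD[OF h] inV[OF that] by blast
      then show False using pair_no_loops[OF that] by simp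
    qed
    then have "(u, v) \<in> R \<union> R\<inverse>" if "(u, v) \<in> parcs S" for u v
      using that symS by (auto simp: R_def dest: linorder_neqE_nat)
    moreover have "(u, v) \<in> parcs S" if "(u, v) \<in> R \<union> R\<inverse>" for u v
      using that symS by (auto simp: R_def split: if_splits)
    ultimately show ?thesis by auto
  qed
  have "(\<Union>t. adj G t \<union> (adj G t)\<inverse>) = R \<union> R\<inverse>"
    unfolding G_def by (auto split: if_splits)
  then have "und G = S" unfolding RS by (simp add: und_def G_def)
  with G show ?thesis by blast
qed

lemma acyclic_coloring_exists:
  assumes "pair_graph G"
  shows "\<exists>c. acyclic_coloring G (card (pverts G)) c"
proof -
  interpret pair_graph G by (rule assms)
  obtain c where c: "bij_betw c (pverts G) {0..<card (pverts G)}"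
    using ex_bij_betw_finite_nat[OF pair_finite_verts] by blast
  have inj: "u = v" if "u \<in> pverts G" "v \<in> pverts G" "c u = c v" for u v
    using that c by (auto simp: bij_betw_def dest: inj_onD)
  have "undirected_forest (with_proj G \<restriction> {v \<in> pverts G. c v = i \<or> c v = j})" for i j
  proof -
    let ?V = "{v \<in> pverts G. c v = i \<or> c v = j}"
    let ?H = "with_proj G \<restriction> ?V"
    interpret H: wf_digraph ?H by (rule wellformed_induce_subgraph)
    have fin: "finite ?V" by simp
    have "card ?V = card (c ` ?V)"
      using inj by (intro card_image[symmetric] inj_onI) auto
    also have "\<dots> \<le> card {i, j}" by (intro card_mono) auto
    also have "\<dots> \<le> 2" by (simp add: card_insert_if)
    finally have card: "card ?V \<le> 2" .
    have "length p \<le> 2" if cyc: "H.cycle p" for p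
    proof -
      obtain u where u: "H.awalk u p u" "distinct (tl (H.awalk_verts u p))"
        using cyc unfolding H.cycle_def by blast
      have "set (H.awalk_verts u p) \<subseteq> verts ?H" using u(1) by (rule H.awalkE)
      then have "set (tl (H.awalk_verts u p)) \<subseteq> ?V"
        using set_drop_subset[of 1 "H.awalk_verts u p"] by (simp add: drop_Suc)
      then have "card (set (tl (H.awalk_verts u p))) \<le> 2"
        using card by (rule le_trans[OF card_mono[OF fin]])
      then show ?thesis
        using u(2) by (simp add: distinct_card H.length_awalk_verts)
    qed
    then show ?thesis by (fastforce simp: undirected_forest_def)
  qed
  moreover have "c u \<noteq> c v" if "(u, v) \<in> parcs G" for u v
    using that inj[of u v] arc_fst_in_verts[OF that] arc_snd_in_verts[OF that]
      pair_no_loops[OF that] by auto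
  moreover have "c \<in> pverts G \<rightarrow> {..<card (pverts G)}"
    using c by (auto simp: bij_betw_def)
  ultimately show ?thesis by (auto simp: acyclic_coloring_def)
qed

end

theory Submission
  imports Defs
begin

text \<open>
  Write \<open>p = 2n + m\<close>, \<open>c = \<lceil>log\<^sub>p log\<^sub>p k\<rceil>\<close> and \<open>L = p^c\<close>, so that \<open>k \<le> p^L\<close>. The \<open>p^e\<close> labellings of the
  \<open>e\<close> edges inside a vertex set \<open>X\<close> are all determined by a map of \<open>X\<close> into \<open>k\<close> points and a labelled
  complete target, so \<open>p^e \<le> p^(k(k-1)/2) * k^|X|\<close>; hence if \<open>|X| \<ge> k\<^sup>2\<close>, some vertex of \<open>X\<close> has at most
  \<open>2L\<close> neighbours in \<open>X\<close>. Peeling off such vertices leaves a set \<open>A\<close> of at most \<open>k\<^sup>2\<close> vertices, each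
  of which gets a private color. Every peeled vertex numbers its at most \<open>2L \<le> p^(c+1)\<close> later
  neighbours, and each base-\<open>p\<close> digit of these numbers is an \<open>(n,m)\<close>-labelling of the graph, with a
  homomorphism to \<open>k\<close> points. The peeled vertices are colored by the tuple of these \<open>c + 1\<close> maps.
  The first peeled vertex of a two-colored cycle would have two later neighbours of one color; equal
  colors force equal digits, hence equal neighbours.
\<close>

section \<open>Labellings\<close>

text \<open>
  The \<open>2n + m\<close> ways of joining an ordered pair \<open>(u,v)\<close>: \<open>2i\<close> is an arc of type \<open>2i + 2\<close> from \<open>u\<close> to
  \<open>v\<close>, \<open>2i + 1\<close> is the same arc reversed, and \<open>a \<ge> 2n\<close> is an edge of type \<open>a + 1\<close>.
\<close>

definition dual_label :: "nat \<Rightarrow> nat \<Rightarrow> nat" where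
  "dual_label n a = (if a < 2 * n then (if even a then a + 1 else a - 1) else a)"

text \<open>The value \<open>0\<close> is not a type: the reversed arc is recorded at the pair \<open>(v,u)\<close> only.\<close>

definition label_type :: "nat \<Rightarrow> nat \<Rightarrow> nat" where
  "label_type n a = (if 2 * n \<le> a then a + 1 else if even a then a + 2 else 0)"

definition labelling :: "nat \<Rightarrow> nat \<Rightarrow> 'a rel \<Rightarrow> ('a \<Rightarrow> 'a \<Rightarrow> nat) \<Rightarrow> bool" where
  "labelling n m E l \<longleftrightarrow> (\<forall>(u, v) \<in> E. l u v < 2 * n + m \<and> l v u = dual_label n (l u v))"

definition label_graph :: "nat \<Rightarrow> 'a set \<Rightarrow> 'a rel \<Rightarrow> ('a \<Rightarrow> 'a \<Rightarrow> nat) \<Rightarrow> 'a nm_pre_graph" where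
  "label_graph n V E l =
     \<lparr> nm_verts = V, adj = (\<lambda>t. {(u, v) \<in> E. t \<noteq> 0 \<and> label_type n (l u v) = t}) \<rparr>"

text \<open>Labels may be prescribed freely in the direction in which \<open>h\<close> increases;
  \<open>dual_label\<close> then forces the opposite direction.\<close>

definition forward_labelling :: "nat \<Rightarrow> ('a \<Rightarrow> nat) \<Rightarrow> ('a \<Rightarrow> 'a \<Rightarrow> nat) \<Rightarrow> 'a \<Rightarrow> 'a \<Rightarrow> nat" where
  "forward_labelling n h g u v = (if h u < h v then g u v else dual_label n (g v u))"

lemma dual_label_less: "a < 2 * n + m \<Longrightarrow> dual_label n a < 2 * n + m"
  unfolding dual_label_def by auto

lemma dual_label_involution [simp]: "dual_label n (dual_label n a) = a"
  unfolding dual_label_def by (auto elim: oddE)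

lemma labelling_forward_labelling:
  assumes "\<And>u v. g u v < 2 * n + m" and "\<And>u v. (u, v) \<in> E \<Longrightarrow> h u \<noteq> h v"
  shows "labelling n m E (forward_labelling n h g)"
  unfolding labelling_def forward_labelling_def
  using assms by (force simp: dual_label_less not_less_iff_gr_or_eq)

lemma label_type_arc:
  assumes "label_type n a \<in> arc_types n"
  shows "a < 2 * n \<and> even a"
  using assms unfolding label_type_def arc_types_def by (auto split: if_splits)

lemma label_type_edge:
  assumes "label_type n a \<in> edge_types n m"
  shows "2 * n \<le> a"
  using assms unfolding label_type_def edge_types_def by (auto split: if_splits)

lemma label_type_mem:
  assumes "a < 2 * n + m" and "label_type n a \<noteq> 0"
  shows "label_type n a \<in> arc_types n \<union> edge_types n m"
proof (cases "2 * n \<le> a")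
  case True
  then show ?thesis using assms by (auto simp: label_type_def edge_types_def)
next
  case False
  then have "even a" using assms by (auto simp: label_type_def split: if_splits)
  then obtain i where "a = 2 * i" by (rule evenE)
  with False have "label_type n a = 2 * (i + 1)" "i + 1 \<in> {1..n}" by (auto simp: label_type_def)
  then show ?thesis unfolding arc_types_def by blast
qed

text \<open>Asymmetry of arcs and symmetry of edges both come from \<open>dual_label\<close>: an
  even label below \<open>2 * n\<close> has an odd dual, of \<open>label_type\<close> 0, while a
  label from \<open>2 * n\<close> on is its own dual.\<close>

lemma nm_graph_label_graph:
  assumes fin: "finite V" and E: "E \<subseteq> V \<times> V" "sym E" "irrefl E" and l: "labelling n m E l"
  shows "nm_graph n m (label_graph n V E l)"
proof
  let ?G = "label_graph n V E l"
  have adj: "(u, v) \<in> adj ?G t \<longleftrightarrow> (u, v) \<in> E \<and> t \<noteq> 0 \<and> label_type n (l u v) = t" for u v t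
    by (simp add: label_graph_def)
  have lab: "l u v < 2 * n + m" "l v u = dual_label n (l u v)" if "(u, v) \<in> E" for u v
    using l that by (auto simp: labelling_def)
  show "finite (nm_verts ?G)" using fin by (simp add: label_graph_def)
  show "adj ?G t \<subseteq> nm_verts ?G \<times> nm_verts ?G" for t using E(1) by (auto simp: label_graph_def)
  show "adj ?G t = {}" if "t \<notin> arc_types n \<union> edge_types n m" for t
    using that label_type_mem[OF lab(1)] by (auto simp: label_graph_def)
  show "(v, v) \<notin> adj ?G t" for v t using E(3) by (auto simp: adj irrefl_def)
  show "(v, u) \<notin> adj ?G t'" if t: "t \<in> arc_types n" and uv: "(u, v) \<in> adj ?G t" for t t' u v
  proof -
    have "(u, v) \<in> E" and "label_type n (l u v) \<in> arc_types n" using t uv by (auto simp: adj)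
    then have "label_type n (l v u) = 0"
      using label_type_arc[of n "l u v"] lab(2)[of u v]
      by (auto simp: dual_label_def label_type_def elim!: evenE)
    then show ?thesis by (auto simp: adj)
  qed
  show "sym (adj ?G t)" if "t \<in> edge_types n m" for t
  proof (rule symI)
    fix u v assume uv: "(u, v) \<in> adj ?G t"
    then have "2 * n \<le> l u v" using that label_type_edge[of n "l u v" m] by (auto simp: adj)
    then have "l v u = l u v" using uv lab(2)[of u v] by (auto simp: adj dual_label_def)
    then show "(v, u) \<in> adj ?G t" using uv symD[OF E(2)] by (auto simp: adj)
  qed
  show "t = t'" if "(u, v) \<in> adj ?G t" "(u, v) \<in> adj ?G t'" for u v t t'
    using that by (simp add: adj)
qed

text \<open>Of a label and its dual at least one has nonzero \<open>label_type\<close>, so no edge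
  of \<open>G\<close> is lost.\<close>

lemma und_label_graph:
  assumes G: "pair_graph G" and l: "labelling n m (parcs G) l"
  shows "und (label_graph n (pverts G) (parcs G) l) = G"
proof -
  interpret pair_graph G by (rule G)
  have symG: "(v, u) \<in> parcs G" if "(u, v) \<in> parcs G" for u v
    using that pair_sym_arcs by (auto simp: symmetric_def sym_def)
  let ?L = "label_graph n (pverts G) (parcs G) l"
  let ?R = "\<Union>t. adj ?L t \<union> (adj ?L t)\<inverse>"
  have "(u, v) \<in> ?R" if uv: "(u, v) \<in> parcs G" for u v
  proof -
    have "l v u = dual_label n (l u v)" using l uv by (auto simp: labelling_def)
    then have "label_type n (l u v) \<noteq> 0 \<or> label_type n (l v u) \<noteq> 0"
      by (auto simp: label_type_def dual_label_def)
    then show ?thesis using uv symG[OF uv] by (auto simp: label_graph_def)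
  qed
  moreover have "(u, v) \<in> parcs G" if "(u, v) \<in> ?R" for u v
    using that symG[of v u] by (auto simp: label_graph_def)
  ultimately have "?R = parcs G" by (intro equalityI subrelI)
  then show ?thesis by (simp add: und_def label_graph_def)
qed

text \<open>The \<open>LEAST\<close> is attained once some target over \<open>nat\<close> is known;
  a renamed copy of the graph itself serves.\<close>

lemma nm_chromatic_label_graph_attained:
  fixes V :: "'a set"
  assumes fin: "finite V" and E: "E \<subseteq> V \<times> V" "sym E" "irrefl E" and l: "labelling n m E l"
  shows "\<exists>H :: nat nm_pre_graph. nm_graph n m H \<and> (\<exists>f. nm_hom (label_graph n V E l) H f) \<and>
    card (nm_verts H) = nm_chromatic n m (label_graph n V E l)"
proof -
  obtain g :: "'a \<Rightarrow> nat" where g: "inj_on g V"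
    using finite_imp_inj_to_nat_seg[OF fin] by blast
  define l' where "l' a b = l (inv_into V g a) (inv_into V g b)" for a b
  define H where "H = label_graph n (g ` V) (map_prod g g ` E) l'"
  have l': "l' (g u) (g v) = l u v" if "(u, v) \<in> E" for u v
    using that E(1) g by (auto simp: l'_def)
  have l'2: "l' (g v) (g u) = l v u" if "(u, v) \<in> E" for u v
    using that E(1) g by (auto simp: l'_def)
  have "nm_graph n m H" unfolding H_def
  proof (rule nm_graph_label_graph)
    show "sym (map_prod g g ` E)"
      using E(2) by (auto simp: sym_def)
    show "irrefl (map_prod g g ` E)"
      using E(1,3) g by (fastforce simp: irrefl_def dest: inj_onD)
    have "l u v < 2 * n + m" "l v u = dual_label n (l u v)" if "(u, v) \<in> E" for u v
      using l that by (auto simp: labelling_def)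
    then show "labelling n m (map_prod g g ` E) l'"
      by (auto simp: labelling_def l' l'2)
  qed (use fin E(1) in auto)
  moreover have "nm_hom (label_graph n V E l) H g"
    unfolding nm_hom_def H_def label_graph_def by (auto simp: l')
  ultimately have "\<exists>c. \<exists>H :: nat nm_pre_graph. nm_graph n m H \<and>
    (\<exists>f. nm_hom (label_graph n V E l) H f) \<and> card (nm_verts H) = c" by blast
  then show ?thesis unfolding nm_chromatic_def by (rule LeastI_ex)
qed

text \<open>The inverse reading of labels. An odd \<open>a = 2 * i + 1\<close> below
  \<open>2 * n\<close> stands for an arc of type \<open>2 * i + 2 = a + 1\<close> that is stored at
  \<open>(v, u)\<close>.\<close>

definition has_label :: "nat \<Rightarrow> nat \<Rightarrow> 'a nm_pre_graph \<Rightarrow> 'a \<Rightarrow> 'a \<Rightarrow> nat \<Rightarrow> bool" where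
  "has_label n m H u v a \<longleftrightarrow> a < 2 * n + m \<and>
     (if 2 * n \<le> a \<or> even a then (u, v) \<in> adj H (label_type n a) else (v, u) \<in> adj H (a + 1))"

lemma label_type_inj:
  assumes "2 * n \<le> a \<or> even a" "2 * n \<le> b \<or> even b" "label_type n a = label_type n b"
  shows "a = b"
  using assms unfolding label_type_def by (auto split: if_splits)

lemma label_type_arcI:
  assumes "a < 2 * n" "even a"
  shows "label_type n a \<in> arc_types n"
  \<comment> \<open>Taking \<open>m = 0\<close> empties \<open>edge_types\<close>, so only arc types
    remain.\<close>
  using assms label_type_mem[of a n 0] by (auto simp: label_type_def edge_types_def)

text \<open>Labels read in the same direction agree by \<open>adj_type_unique\<close>. Readings in
  opposite directions would join \<open>u\<close> and \<open>v\<close> both ways, once by an arc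
  type, against \<open>arc_asym\<close>.\<close>

lemma (in nm_graph) has_label_unique:
  assumes "has_label n m G u v a" "has_label n m G u v b"
  shows "a = b"
proof -
  have odd: "a + 1 \<in> arc_types n" if "\<not> (2 * n \<le> a \<or> even a)" for a
    using that label_type_arcI[of "a - 1" n] by (auto simp: label_type_def elim!: oddE)
  show ?thesis
  proof (cases "2 * n \<le> a \<or> even a"; cases "2 * n \<le> b \<or> even b")
    assume "2 * n \<le> a \<or> even a" "2 * n \<le> b \<or> even b"
    then show ?thesis
      using assms label_type_inj adj_type_unique by (metis has_label_def)
  next
    assume "2 * n \<le> a \<or> even a" and b: "\<not> (2 * n \<le> b \<or> even b)"
    then show ?thesis using assms arc_asym[OF odd[OF b]] by (auto simp: has_label_def)
  next
    assume a: "\<not> (2 * n \<le> a \<or> even a)" and "2 * n \<le> b \<or> even b"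
    then show ?thesis using assms arc_asym[OF odd[OF a]] by (auto simp: has_label_def)
  next
    assume "\<not> (2 * n \<le> a \<or> even a)" "\<not> (2 * n \<le> b \<or> even b)"
    then show ?thesis
      using assms adj_type_unique by (metis has_label_def add_right_cancel)
  qed
qed

text \<open>
  A homomorphism to a target of order at most \<open>k\<close>, with the target reduced to a table \<open>T\<close> of labels
  on the points \<open>0, \<dots>, k - 1\<close>.
\<close>

lemma label_table:
  fixes G :: "'a pair_pre_digraph"
  assumes G: "pair_graph G" and k: "nm_chromatic_simple n m G = k" and l: "labelling n m (parcs G) l"
  shows "\<exists>f T. f \<in> pverts G \<rightarrow> {..<k} \<and>
    (\<forall>u v. (u, v) \<in> parcs G \<longrightarrow> f u \<noteq> f v \<and> T (f u) (f v) = l u v)"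
proof -
  interpret pair_graph G by (rule G)
  have E: "parcs G \<subseteq> pverts G \<times> pverts G"
    using arc_fst_in_verts arc_snd_in_verts by fastforce
  have sym: "sym (parcs G)" using pair_sym_arcs by (simp add: symmetric_def)
  have irr: "irrefl (parcs G)" using pair_no_loops by (fastforce simp: irrefl_def)
  let ?L = "label_graph n (pverts G) (parcs G) l"
  note L = nm_graph_label_graph[OF pair_finite_verts E sym irr l]
  obtain H :: "nat nm_pre_graph" and f where H: "nm_graph n m H" and f: "nm_hom ?L H f"
    and c: "card (nm_verts H) = nm_chromatic n m ?L"
    using nm_chromatic_label_graph_attained[OF pair_finite_verts E sym irr l] by blast
  interpret H: nm_graph n m H by (rule H)
  \<comment> \<open>The labelled graph competes in the maximum that defines \<open>k\<close>, so its
    smallest target has at most \<open>k\<close> vertices.\<close>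
  have "nm_chromatic n m ?L \<in> {nm_chromatic n m G' | G'. nm_graph n m G' \<and> und G' = G}"
    using L und_label_graph[OF G l] by blast
  from Max_ge[OF finite_nm_chromatic_values this] have "card (nm_verts H) \<le> card {..<k}"
    using c k unfolding nm_chromatic_simple_def by simp
  then obtain g where g: "inj_on g (nm_verts H)" "g ` nm_verts H \<subseteq> {..<k}"
    using inj_on_iff_card_le[OF H.finite_nm_verts finite_lessThan] by blast
  \<comment> \<open>Where the target has no label, \<open>THE\<close> is unspecified, so
    \<open>T\<close> is not bounded there.\<close>
  define T where "T a b = (THE x. has_label n m H (inv_into (nm_verts H) g a)
     (inv_into (nm_verts H) g b) x)" for a b
  have fV: "f u \<in> nm_verts H" if "u \<in> pverts G" for u
    using f that by (auto simp: nm_hom_def label_graph_def)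
  have hom: "(f u, f v) \<in> adj H (label_type n (l u v))"
    if "(u, v) \<in> parcs G" "label_type n (l u v) \<noteq> 0" for u v
    using f that unfolding nm_hom_def label_graph_def by simp
  have ll: "l u v < 2 * n + m" "l v u = dual_label n (l u v)" if "(u, v) \<in> parcs G" for u v
    using l that by (auto simp: labelling_def)
  have lab: "has_label n m H (f u) (f v) (l u v)" if uv: "(u, v) \<in> parcs G" for u v
  proof (cases "2 * n \<le> l u v \<or> even (l u v)")
    case True
    then have "label_type n (l u v) \<noteq> 0" by (auto simp: label_type_def)
    then show ?thesis using True hom[OF uv] ll(1)[OF uv] by (simp add: has_label_def)
  next
    case False
    \<comment> \<open>A reversed arc is stored at \<open>(v, u)\<close>, so the homomorphism is
      applied to that pair.\<close>
    then have "label_type n (l v u) = l u v + 1"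
      using ll(2)[OF uv] by (auto simp: label_type_def dual_label_def elim!: oddE)
    then show ?thesis
      using False hom[OF symD[OF sym uv]] ll(1)[OF uv] by (simp add: has_label_def)
  qed
  have "g (f u) \<noteq> g (f v)" if uv: "(u, v) \<in> parcs G" for u v
  proof -
    have "f u \<noteq> f v"
      using lab[OF uv] H.adj_irrefl by (auto simp: has_label_def split: if_splits)
    moreover have "u \<in> pverts G" "v \<in> pverts G" using E uv by auto
    ultimately show ?thesis using fV inj_on_eq_iff[OF g(1)] by simp
  qed
  moreover have "T (g (f u)) (g (f v)) = l u v" if uv: "(u, v) \<in> parcs G" for u v
  proof -
    have "u \<in> pverts G" "v \<in> pverts G" using E uv by auto
    then have "inv_into (nm_verts H) g (g (f u)) = f u" "inv_into (nm_verts H) g (g (f v)) = f v"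
      using g(1) fV by simp_all
    then have "T (g (f u)) (g (f v)) = (THE x. has_label n m H (f u) (f v) x)"
      by (simp add: T_def)
    also have "\<dots> = l u v"
      using lab[OF uv] by (rule the_equality) (rule H.has_label_unique[OF _ lab[OF uv]])
    finally show ?thesis .
  qed
  ultimately have "\<forall>u v. (u, v) \<in> parcs G \<longrightarrow>
      (g \<circ> f) u \<noteq> (g \<circ> f) v \<and> T ((g \<circ> f) u) ((g \<circ> f) v) = l u v"
    by simp
  moreover have "g \<circ> f \<in> pverts G \<rightarrow> {..<k}"
    using g(2) fV by (simp add: Pi_iff image_subset_iff)
  ultimately show ?thesis by (intro exI[of _ "g \<circ> f"] exI[of _ T] conjI)
qed


section \<open>Degeneracy\<close>

lemma two_times_sum_lessThan: "2 * (\<Sum>b<k. b) = k * (k - 1)" for k :: nat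
  by (induction k) (auto simp: algebra_simps)

text \<open>This is the square of the counting bound: \<open>parcs G\<close> contains every edge in
  both directions, and squaring avoids halved exponents.\<close>

lemma labelling_count:
  fixes G :: "'a pair_pre_digraph"
  assumes G: "pair_graph G" and k: "nm_chromatic_simple n m G = k"
    and p: "0 < 2 * n + m" and X: "X \<subseteq> pverts G"
  shows "(2 * n + m) ^ card (parcs G \<inter> X \<times> X) \<le> (2 * n + m) ^ (k * (k - 1)) * k ^ (2 * card X)"
proof -
  interpret pair_graph G by (rule G)
  let ?p = "2 * n + m"
  obtain h :: "'a \<Rightarrow> nat" where h: "inj_on h (pverts G)"
    using finite_imp_inj_to_nat_seg[OF pair_finite_verts] by blast
  have hne: "h u \<noteq> h v" if "(u, v) \<in> parcs G" for u v
    using that inj_onD[OF h, of u v] arc_fst_in_verts[OF that] arc_snd_in_verts[OF that]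
      pair_no_loops[OF that] by auto
  have symG: "(v, u) \<in> parcs G" if "(u, v) \<in> parcs G" for u v
    using that pair_sym_arcs by (auto simp: symmetric_def sym_def)
  \<comment> \<open>\<open>F\<close> contains each edge inside \<open>X\<close> once, directed along
    \<open>h\<close>; \<open>P\<close> contains each pair of distinct points once, larger point
    first.\<close>
  define F where "F = {(u, v) \<in> parcs G \<inter> X \<times> X. h u < h v}"
  define P where "P = (SIGMA b : {..<k}. {..<b})"
  have finX: "finite X" using X pair_finite_verts by (rule finite_subset)
  have finF: "finite F" unfolding F_def by (rule finite_subset[of _ "X \<times> X"]) (use finX in auto)
  have finP: "finite P" by (simp add: P_def)
  have "(u, v) \<in> parcs G \<inter> X \<times> X \<longleftrightarrow> (u, v) \<in> F \<union> F\<inverse>" for u v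
    using hne[of u v] symG[of u v] symG[of v u] by (auto simp: F_def)
  then have "parcs G \<inter> X \<times> X = F \<union> F\<inverse>" by (intro set_eqI) (metis surj_pair)
  moreover have "F \<inter> F\<inverse> = {}" by (auto simp: F_def)
  ultimately have cardE: "card (parcs G \<inter> X \<times> X) = 2 * card F"
    using card_Un_disjoint[of F "F\<inverse>"] finF by simp
  have cardP: "2 * card P = k * (k - 1)"
    by (simp add: P_def two_times_sum_lessThan)
  \<comment> \<open>\<open>D\<close> decodes a vertex map and half a table into labels on
    \<open>F\<close>; the missing half of the table is recovered by duality.\<close>
  define D where "D = (\<lambda>(f :: 'a \<Rightarrow> nat, T). \<lambda>(u, v) \<in> F. if f v < f u then T (f u, f v)
     else dual_label n (T (f v, f u)) :: nat)"
  have "(F \<rightarrow>\<^sub>E {..<?p}) \<subseteq> D ` ((X \<rightarrow>\<^sub>E {..<k}) \<times> (P \<rightarrow>\<^sub>E {..<?p}))"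
  proof
    fix \<phi> assume \<phi>: "\<phi> \<in> F \<rightarrow>\<^sub>E {..<?p}"
    \<comment> \<open>All of \<open>G\<close> has to be labelled, so pairs outside \<open>F\<close>
      receive the default 0.\<close>
    define g where "g u v = (if (u, v) \<in> F then \<phi> (u, v) else 0)" for u v
    have \<phi>_lt: "\<phi> x < ?p" if "x \<in> F" for x using PiE_mem[OF \<phi> that] by simp
    have "g u v < ?p" for u v
      using \<phi>_lt[of "(u, v)"] p by (cases "(u, v) \<in> F") (simp_all only: g_def if_True if_False)
    then have l: "labelling n m (parcs G) (forward_labelling n h g)"
      using hne by (rule labelling_forward_labelling)
    obtain f T where f: "f \<in> pverts G \<rightarrow> {..<k}"
      and T: "\<And>u v. (u, v) \<in> parcs G \<Longrightarrow> f u \<noteq> f v \<and> T (f u) (f v) = forward_labelling n h g u v"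
      using label_table[OF G k l] by blast
    \<comment> \<open>Reduction modulo \<open>?p\<close> brings the unspecified entries into range
      and keeps those that occur as labels.\<close>
    define T' where "T' = (\<lambda>(b, a) \<in> P. T b a mod ?p)"
    have "\<phi> x = D (restrict f X, T') x" for x
    proof (cases "x \<in> F")
      case True
      then obtain u v where x: "x = (u, v)" and uv: "(u, v) \<in> F" by (cases x) auto
      then have uvG: "(u, v) \<in> parcs G" "u \<in> X" "v \<in> X" "h u < h v" by (auto simp: F_def)
      note lt = \<phi>_lt[OF uv]
      have fk: "f u < k" "f v < k" using f X uvG by auto
      have Tuv: "T (f u) (f v) = \<phi> (u, v)"
        using T[OF uvG(1)] uvG uv by (simp add: forward_labelling_def g_def)
      have Tvu: "T (f v) (f u) = dual_label n (\<phi> (u, v))"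
        using T[OF symG[OF uvG(1)]] uvG uv by (simp add: forward_labelling_def g_def)
      have "f u \<noteq> f v" using T[OF uvG(1)] by blast
      then consider "f v < f u" | "f u < f v" by linarith
      then show ?thesis
        using uv uvG lt fk Tuv Tvu dual_label_less[OF lt]
        by cases (auto simp: x D_def T'_def P_def)
    next
      case False
      then have "D (restrict f X, T') x = undefined" by (cases x) (simp add: D_def)
      then show ?thesis using PiE_arb[OF \<phi> False] by simp
    qed
    then have "\<phi> = D (restrict f X, T')" by blast
    moreover have "restrict f X \<in> X \<rightarrow>\<^sub>E {..<k}" using f X by auto
    moreover have "T' \<in> P \<rightarrow>\<^sub>E {..<?p}" using p by (auto simp: T'_def)
    ultimately show "\<phi> \<in> D ` ((X \<rightarrow>\<^sub>E {..<k}) \<times> (P \<rightarrow>\<^sub>E {..<?p}))" by blast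
  qed
  then have "card (F \<rightarrow>\<^sub>E {..<?p}) \<le> card ((X \<rightarrow>\<^sub>E {..<k}) \<times> (P \<rightarrow>\<^sub>E {..<?p}))"
    using finX finP by (intro surj_card_le) (auto intro!: finite_PiE)
  then have "?p ^ card F \<le> k ^ card X * ?p ^ card P"
    using finX finP finF by (simp add: card_PiE card_cartesian_product)
  then have "(?p ^ card F) ^ 2 \<le> (k ^ card X * ?p ^ card P) ^ 2"
    by (rule power_mono) simp
  then show ?thesis
    unfolding cardE cardP[symmetric]
    by (simp add: power_mult_distrib power_mult[symmetric] mult.commute)
qed

text \<open>If all degrees in \<open>X\<close> were at least \<open>2 * L + 1\<close>, comparing
  exponents in \<open>labelling_count\<close> would give
  \<open>card X * (2 * L + 1) \<le> k * (k - 1) + 2 * L * card X\<close>, hence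
  \<open>card X \<le> k * (k - 1)\<close>.\<close>

lemma low_degree_vertex:
  fixes G :: "'a pair_pre_digraph"
  assumes G: "pair_graph G" and k: "nm_chromatic_simple n m G = k"
    and p: "2 \<le> 2 * n + m" and kL: "1 \<le> k" "k \<le> (2 * n + m) ^ L"
    and X: "X \<subseteq> pverts G" "k\<^sup>2 \<le> card X"
  shows "\<exists>v\<in>X. card {w \<in> X. (v, w) \<in> parcs G} \<le> 2 * L"
proof (rule ccontr)
  assume "\<not> ?thesis"
  then have deg: "2 * L + 1 \<le> card {w \<in> X. (v, w) \<in> parcs G}" if "v \<in> X" for v
    using that by (auto simp: not_le Suc_le_eq)
  interpret pair_graph G by (rule G)
  let ?p = "2 * n + m"
  have finX: "finite X" using X(1) pair_finite_verts by (rule finite_subset)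
  have "card X * (2 * L + 1) \<le> (\<Sum>v\<in>X. card {w \<in> X. (v, w) \<in> parcs G})"
    using sum_bounded_below[of X "2 * L + 1"] deg by simp
  also have "\<dots> = card (SIGMA v : X. {w \<in> X. (v, w) \<in> parcs G})"
    using finX by simp
  also have "(SIGMA v : X. {w \<in> X. (v, w) \<in> parcs G}) = parcs G \<inter> X \<times> X" by auto
  finally have E: "card X * (2 * L + 1) \<le> card (parcs G \<inter> X \<times> X)" .
  have "?p ^ card (parcs G \<inter> X \<times> X) \<le> ?p ^ (k * (k - 1)) * k ^ (2 * card X)"
    using p by (intro labelling_count[OF G k _ X(1)]) linarith
  also have "\<dots> \<le> ?p ^ (k * (k - 1)) * (?p ^ L) ^ (2 * card X)"
    using kL(2) by (intro mult_left_mono power_mono) auto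
  also have "\<dots> = ?p ^ (k * (k - 1) + L * (2 * card X))"
    by (simp add: power_add power_mult)
  finally have "card (parcs G \<inter> X \<times> X) \<le> k * (k - 1) + L * (2 * card X)"
    using p by (subst (asm) power_increasing_iff) auto
  moreover have "k * (k - 1) < card X"
    using kL(1) X(2) by (auto simp: power2_eq_square intro: less_le_trans[of _ "k * k"])
  ultimately show False using E by (simp add: algebra_simps)
qed

text \<open>Each removed vertex is ranked below all that remain; once fewer than \<open>N\<close>
  vertices are left, they form \<open>A\<close>.\<close>

lemma degenerate_order:
  fixes E :: "'a rel"
  assumes "finite V" and "\<And>X. X \<subseteq> V \<Longrightarrow> N \<le> card X \<Longrightarrow> \<exists>v\<in>X. card {w \<in> X. (v, w) \<in> E} \<le> d"
  shows "\<exists>A (h :: 'a \<Rightarrow> nat). A \<subseteq> V \<and> card A \<le> N \<and> inj_on h V \<and>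
    (\<forall>v \<in> V - A. card {w \<in> V. (v, w) \<in> E \<and> h v < h w} \<le> d)"
  using assms
proof (induction V rule: finite_psubset_induct)
  case (psubset V)
  show ?case
  proof (cases "N \<le> card V")
    case False
    obtain h :: "'a \<Rightarrow> nat" where "inj_on h V"
      using finite_imp_inj_to_nat_seg[OF psubset.hyps] by blast
    with False show ?thesis by (intro exI[of _ V] exI[of _ h]) auto
  next
    case True
    then obtain v where v: "v \<in> V" "card {w \<in> V. (v, w) \<in> E} \<le> d"
      using psubset.prems by blast
    have sub: "V - {v} \<subset> V" using v(1) by blast
    have deg: "\<exists>v\<in>X. card {w \<in> X. (v, w) \<in> E} \<le> d" if "X \<subseteq> V - {v}" "N \<le> card X" for X
      using that by (intro psubset.prems) auto
    from psubset.IH[OF sub deg] obtain A and h :: "'a \<Rightarrow> nat" where A: "A \<subseteq> V - {v}" "card A \<le> N"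
      and h: "inj_on h (V - {v})"
      and d: "\<forall>x \<in> V - {v} - A. card {w \<in> V - {v}. (x, w) \<in> E \<and> h x < h w} \<le> d"
      by blast
    \<comment> \<open>Rank 0 makes every other vertex later than \<open>v\<close>, and the shift
      preserves all other comparisons.\<close>
    define h' where "h' w = (if w = v then 0 else Suc (h w))" for w
    have "inj_on h' V" using h by (auto simp: inj_on_def h'_def)
    moreover have "card {w \<in> V. (x, w) \<in> E \<and> h' x < h' w} \<le> d" if x: "x \<in> V - A" for x
    proof (cases "x = v")
      case True
      have "card {w \<in> V. (x, w) \<in> E \<and> h' x < h' w} \<le> card {w \<in> V. (v, w) \<in> E}"
        using True psubset.hyps by (intro card_mono) auto
      then show ?thesis using v(2) by linarith
    next
      case False
      have "{w \<in> V. (x, w) \<in> E \<and> h' x < h' w} = {w \<in> V - {v}. (x, w) \<in> E \<and> h x < h w}"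
        using False by (auto simp: h'_def)
      then show ?thesis using d x False by simp
    qed
    ultimately show ?thesis using A by (intro exI[of _ A] exI[of _ h'] conjI ballI) auto
  qed
qed


section \<open>The acyclic coloring\<close>

lemma (in pre_digraph) awalk_verts_nth:
  assumes "cas u p v" "i < length p"
  shows "awalk_verts u p ! i = tail G (p ! i) \<and> awalk_verts u p ! Suc i = head G (p ! i)"
  using assms
proof (induction p arbitrary: u i)
  case (Cons e p)
  have "awalk_verts (head G e) p ! 0 = head G e"
    using Cons.prems by (cases p) auto
  then show ?case using Cons by (cases i) auto
qed simp

text \<open>Every vertex of a cycle of length at least 3 has two distinct neighbours on the cycle,
  so the vertex set of a cycle would violate \<open>leaf\<close>.\<close>

lemma undirected_forestI:
  assumes G: "pair_graph G"
    and leaf: "\<And>W. finite W \<Longrightarrow> W \<subseteq> V \<Longrightarrow> W \<noteq> {} \<Longrightarrow>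
      \<exists>w\<in>W. \<forall>x\<in>W. \<forall>y\<in>W. (w, x) \<in> parcs G \<longrightarrow> (w, y) \<in> parcs G \<longrightarrow> x = y"
  shows "undirected_forest (with_proj G \<restriction> V)"
  unfolding undirected_forest_def
proof (rule notI, elim exE conjE)
  interpret pair_graph G by (rule G)
  let ?H = "with_proj G \<restriction> V"
  interpret H: wf_digraph ?H by (rule wellformed_induce_subgraph)
  fix p assume cyc: "H.cycle p" and len: "3 \<le> length p"
  obtain u where u: "H.awalk u p u" "distinct (tl (H.awalk_verts u p))"
    using cyc unfolding H.cycle_def by blast
  define xs where "xs = H.awalk_verts u p"
  let ?N = "length p"
  have lxs: "length xs = Suc ?N" by (simp add: xs_def H.length_awalk_verts)
  have cas: "H.cas u p u" using u(1) by blast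
  have arc: "(xs ! i, xs ! Suc i) \<in> parcs G" if "i < ?N" for i
  proof -
    have "p ! i \<in> arcs ?H" using u(1) that by (meson H.awalkE nth_mem subsetD)
    then show ?thesis
      using H.awalk_verts_nth[OF cas that] by (simp add: xs_def)
  qed
  have symG: "(b, a) \<in> parcs G" if "(a, b) \<in> parcs G" for a b
    using that pair_sym_arcs by (auto simp: symmetric_def sym_def)
  have ends: "xs ! 0 = u" "xs ! ?N = u"
    using H.awhd_if_cas[OF cas] H.awlast_if_cas[OF cas] lxs
    by (simp_all add: xs_def hd_conv_nth last_conv_nth)
  have inj: "xs ! i \<noteq> xs ! j" if "1 \<le> i" "i \<le> ?N" "1 \<le> j" "j \<le> ?N" "i \<noteq> j" for i j
  proof -
    have "distinct (tl xs)" using u(2) by (simp add: xs_def)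
    then have "tl xs ! (i - 1) \<noteq> tl xs ! (j - 1)"
      using that lxs by (subst nth_eq_iff_index_eq) auto
    then show ?thesis using that lxs by (simp add: nth_tl)
  qed
  \<comment> \<open>Index 0 is left out because the walk returns to its start at index
    \<open>?N\<close>; the remaining entries are distinct.\<close>
  define W where "W = (\<lambda>i. xs ! i) ` {1..?N}"
  have "set xs \<subseteq> verts ?H" using u(1) unfolding xs_def by (rule H.awalkE)
  then have "set xs \<subseteq> V" by simp
  then have "W \<subseteq> V" using lxs by (auto simp: W_def)
  moreover have "finite W" "W \<noteq> {}" using len by (auto simp: W_def)
  ultimately have "\<exists>w\<in>W. \<forall>x\<in>W. \<forall>y\<in>W. (w, x) \<in> parcs G \<longrightarrow> (w, y) \<in> parcs G \<longrightarrow> x = y"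
    by (intro leaf)
  then obtain w where w: "w \<in> W"
    and uniq: "\<And>x y. x \<in> W \<Longrightarrow> y \<in> W \<Longrightarrow> (w, x) \<in> parcs G \<Longrightarrow> (w, y) \<in> parcs G \<Longrightarrow> x = y"
    by blast
  from w obtain i where i: "1 \<le> i" "i \<le> ?N" "w = xs ! i" by (auto simp: W_def)
  \<comment> \<open>\<open>a\<close> and \<open>b\<close> are the cyclic predecessor and successor
    of \<open>i\<close> in \<open>{1..?N}\<close>; they differ because
    \<open>3 \<le> ?N\<close>.\<close>
  define a where "a = (if i = 1 then ?N else i - 1)"
  define b where "b = (if i = ?N then 1 else Suc i)"
  have ab: "1 \<le> a" "a \<le> ?N" "1 \<le> b" "b \<le> ?N" "a \<noteq> b"
    using i len by (auto simp: a_def b_def)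
  have "i - 1 < ?N" "Suc (i - 1) = i" using i by auto
  then have "(w, xs ! (i - 1)) \<in> parcs G" using symG[OF arc[of "i - 1"]] i(3) by simp
  then have "(w, xs ! a) \<in> parcs G" using ends by (cases "i = 1") (simp_all add: a_def)
  moreover have "(w, xs ! b) \<in> parcs G"
  proof (cases "i = ?N")
    case True
    have "0 < ?N" using len by linarith
    from arc[OF this] show ?thesis using True i(3) ends by (simp add: b_def)
  next
    case False
    then have "i < ?N" using i(2) by simp
    from arc[OF this] show ?thesis using False i(3) by (simp add: b_def)
  qed
  ultimately have "xs ! a = xs ! b"
    using ab by (intro uniq) (auto simp: W_def)
  then show False using inj ab by blast
qed

lemma eq_if_digits_eq:
  fixes x y p :: nat
  assumes "x < p ^ r" "y < p ^ r" and "\<And>i. i < r \<Longrightarrow> x div p ^ i mod p = y div p ^ i mod p"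
  shows "x = y"
  using assms
proof (induction r arbitrary: x y)
  case (Suc r)
  have "x div p = y div p"
  proof (rule Suc.IH)
    show "x div p < p ^ r" "y div p < p ^ r"
      using Suc.prems by (simp_all add: less_mult_imp_div_less mult.commute)
    show "x div p div p ^ i mod p = y div p div p ^ i mod p" if "i < r" for i
      using Suc.prems(3)[of "Suc i"] that by (simp add: div_mult2_eq)
  qed
  moreover have "x mod p = y mod p" using Suc.prems(3)[of 0] by simp
  ultimately show ?case by (metis div_mult_mod_eq)
qed simp

lemma acyclic_chromatic_le:
  fixes G :: "'a pair_pre_digraph"
  assumes G: "pair_graph G" and k: "nm_chromatic_simple n m G = k"
    and p: "2 \<le> 2 * n + m" and k1: "1 \<le> k" and kc: "k \<le> (2 * n + m) ^ ((2 * n + m) ^ c)"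
  shows "acyclic_chromatic G \<le> k\<^sup>2 + k ^ (c + 1)"
proof -
  interpret pair_graph G by (rule G)
  let ?p = "2 * n + m" and ?V = "pverts G" and ?E = "parcs G"
  have V: "u \<in> ?V" "v \<in> ?V" if "(u, v) \<in> ?E" for u v
    using arc_fst_in_verts[OF that] arc_snd_in_verts[OF that] by simp_all
  have symG: "(v, u) \<in> ?E" if "(u, v) \<in> ?E" for u v
    using that pair_sym_arcs by (auto simp: symmetric_def sym_def)
  have "\<exists>A (h :: 'a \<Rightarrow> nat). A \<subseteq> ?V \<and> card A \<le> k\<^sup>2 \<and> inj_on h ?V \<and>
    (\<forall>v \<in> ?V - A. card {w \<in> ?V. (v, w) \<in> ?E \<and> h v < h w} \<le> 2 * ?p ^ c)"
    using pair_finite_verts low_degree_vertex[OF G k p k1 kc] by (rule degenerate_order)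
  then obtain A and h :: "'a \<Rightarrow> nat" where A: "A \<subseteq> ?V" "card A \<le> k\<^sup>2" and h: "inj_on h ?V"
    and d: "\<forall>v \<in> ?V - A. card {w \<in> ?V. (v, w) \<in> ?E \<and> h v < h w} \<le> 2 * ?p ^ c"
    by (elim exE conjE)
  have hne: "h u \<noteq> h v" if "(u, v) \<in> ?E" for u v
    using that inj_onD[OF h, of u v] V[OF that] pair_no_loops[OF that] by auto
  define N where "N v = {w \<in> ?V. (v, w) \<in> ?E \<and> h v < h w}" for v
  have "\<exists>f. inj_on f (N v) \<and> f ` N v \<subseteq> {..<?p ^ (c + 1)}" if "v \<in> ?V - A" for v
  proof -
    have "card (N v) \<le> 2 * ?p ^ c" using d that by (simp add: N_def)
    \<comment> \<open>The factor 2 is at most \<open>?p\<close> and costs one more digit, whence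
      \<open>c + 1\<close> maps instead of \<open>c\<close>.\<close>
    also have "\<dots> \<le> ?p ^ (c + 1)" using p by simp
    finally show ?thesis
      using inj_on_iff_card_le[of "N v" "{..<?p ^ (c + 1)}"] by (simp add: N_def)
  qed
  then obtain j where j: "\<And>v. v \<in> ?V - A \<Longrightarrow> inj_on (j v) (N v) \<and> j v ` N v \<subseteq> {..<?p ^ (c + 1)}"
    by metis
  \<comment> \<open>Digit \<open>i\<close> of the number that \<open>u\<close> gives to
    \<open>v\<close>. It carries information only for \<open>u\<close> outside \<open>A\<close> and
    \<open>v\<close> in \<open>N u\<close>, but is below \<open>?p\<close> everywhere, as a
    labelling requires.\<close>
  define g where "g i u v = j u v div ?p ^ i mod ?p" for i u v
  have "g i u v < ?p" for i u v unfolding g_def using p by (intro mod_less_divisor) linarith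
  then have "labelling n m ?E (forward_labelling n h (g i))" for i
    using hne by (rule labelling_forward_labelling)
  from label_table[OF G k this]
  obtain f T where f: "\<And>i. f i \<in> ?V \<rightarrow> {..<k}"
    and T: "\<And>i u v. (u, v) \<in> ?E \<Longrightarrow>
      f i u \<noteq> f i v \<and> T i (f i u) (f i v) = forward_labelling n h (g i) u v"
    by metis
  let ?K = "k ^ (c + 1)"
  have "card ({..<c + 1} \<rightarrow>\<^sub>E {..<k}) \<le> card {..<?K}" by (simp add: card_PiE)
  then obtain e where e: "inj_on e ({..<c + 1} \<rightarrow>\<^sub>E {..<k})" "e ` ({..<c + 1} \<rightarrow>\<^sub>E {..<k}) \<subseteq> {..<?K}"
    using inj_on_iff_card_le[of "{..<c + 1} \<rightarrow>\<^sub>E {..<k}" "{..<?K}"] by (auto simp: finite_PiE)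
  have "finite A" using A(1) pair_finite_verts by (rule finite_subset)
  then obtain a where a: "inj_on a A" "a ` A \<subseteq> {..<k\<^sup>2}"
    using A(2) inj_on_iff_card_le[of A "{..<k\<^sup>2}"] by auto
  \<comment> \<open>Tuples are encoded by numbers below \<open>?K\<close>; the colors from
    \<open>?K\<close> on are private to the vertices of \<open>A\<close>.\<close>
  define col where "col v = (if v \<in> A then ?K + a v else e (\<lambda>i\<in>{..<c + 1}. f i v))" for v
  have tup: "(\<lambda>i\<in>{..<c + 1}. f i v) \<in> {..<c + 1} \<rightarrow>\<^sub>E {..<k}" if "v \<in> ?V" for v
    using f that by auto
  have e_lt: "e (\<lambda>i\<in>{..<c + 1}. f i v) < ?K" if "v \<in> ?V" for v
    using e(2) tup[OF that] by blast
  have a_lt: "a v < k\<^sup>2" if "v \<in> A" for v using a(2) that by blast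
  have colA: "v \<in> A \<longleftrightarrow> ?K \<le> col v" if "v \<in> ?V" for v
    unfolding col_def using e_lt[OF that] by (simp split: if_split)
  have col_lt: "col v < k\<^sup>2 + ?K" if "v \<in> ?V" for v
    unfolding col_def using e_lt[OF that] a_lt[of v] by (simp split: if_split)
  have colA_eq: "u = v" if "u \<in> A" "v \<in> ?V" "col u = col v" for u v
  proof -
    have "v \<in> A" using that A(1) colA[of u] colA[of v] by auto
    then show ?thesis using that a(1) by (auto simp: col_def dest: inj_onD)
  qed
  have col_eq: "f i u = f i v"
    if "u \<in> ?V - A" "v \<in> ?V - A" "col u = col v" "i < c + 1" for u v i
  proof -
    have "(\<lambda>i\<in>{..<c + 1}. f i u) = (\<lambda>i\<in>{..<c + 1}. f i v)"
      using that tup by (intro inj_onD[OF e(1)]) (auto simp: col_def)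
    from fun_cong[OF this, of i] show ?thesis using that(4) by simp
  qed
  have proper: "col u \<noteq> col v" if uv: "(u, v) \<in> ?E" for u v
  proof
    assume eq: "col u = col v"
    show False
    proof (cases "u \<in> A")
      case True
      then show False using colA_eq[OF _ _ eq] V[OF uv] pair_no_loops[OF uv] by simp
    next
      case False
      then have "v \<notin> A" using colA V[OF uv] eq by simp
      then show False using False col_eq[OF _ _ eq, of 0] V[OF uv] T[OF uv, of 0] by simp
    qed
  qed
  have leaf: "\<exists>w\<in>W. \<forall>x\<in>W. \<forall>y\<in>W. (w, x) \<in> ?E \<longrightarrow> (w, y) \<in> ?E \<longrightarrow> x = y"
    if W: "finite W" "W \<subseteq> {v \<in> ?V. col v = s \<or> col v = t}" "W \<noteq> {}" for W s t
  proof -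
    have two: "col x = col y \<or> col z = col x \<or> col z = col y"
      if "x \<in> W" "y \<in> W" "z \<in> W" for x y z
      using W(2) that by (metis (mono_tags, lifting) mem_Collect_eq subsetD)
    show ?thesis
    proof (cases "W \<inter> A = {}")
      \<comment> \<open>A vertex \<open>v\<close> of \<open>A\<close> is alone in its color. If it
        has a neighbour \<open>w\<close> in \<open>W\<close>, all neighbours of \<open>w\<close> in
        \<open>W\<close> must have the color of \<open>v\<close>, so they equal \<open>v\<close>;
        otherwise \<open>v\<close> itself qualifies.\<close>
      case False
      then obtain v where v: "v \<in> W" "v \<in> A" by blast
      show ?thesis
      proof (cases "\<exists>w\<in>W. (v, w) \<in> ?E")
        case True
        then obtain w where w: "w \<in> W" "(v, w) \<in> ?E" by blast
        have "x = v" if x: "x \<in> W" "(w, x) \<in> ?E" for x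
        proof -
          have "col x = col v"
            using two[OF v(1) x(1) w(1)] proper[OF w(2)] proper[OF x(2)] by metis
          then show ?thesis using colA_eq[OF v(2) V(2)[OF x(2)]] by simp
        qed
        with w(1) show ?thesis by blast
      qed (use v(1) in blast)
    next
      case True
      define w where "w = arg_min_on h W"
      have w: "w \<in> W" "\<And>x. x \<in> W \<Longrightarrow> h w \<le> h x"
        using arg_min_if_finite(1)[OF W(1,3), of h] arg_min_least[OF W(1,3), of _ h]
        by (auto simp: w_def)
      have wV: "w \<in> ?V - A" using w(1) W(2) True by blast
      have "x = y" if xy: "x \<in> W" "y \<in> W" "(w, x) \<in> ?E" "(w, y) \<in> ?E" for x y
      proof -
        have lt: "h w < h x" "h w < h y"
          using w(2) xy hne[OF xy(3)] hne[OF xy(4)] by (simp_all add: less_le)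
        have xyV: "x \<in> ?V - A" "y \<in> ?V - A" using xy W(2) True by auto
        have "col x = col y"
          using two[OF xy(1,2) w(1)] proper[OF xy(3)] proper[OF xy(4)] by metis
        then have feq: "f i x = f i y" if "i < c + 1" for i
          using col_eq[OF xyV] that by blast
        \<comment> \<open>The table gives the label of \<open>(w, x)\<close> from
          \<open>f i w\<close> and \<open>f i x\<close> alone, and \<open>h\<close> increases from
          \<open>w\<close>, so this label is the digit itself and not its dual.\<close>
        have "g i w x = g i w y" if "i < c + 1" for i
          using T[OF xy(3), of i] T[OF xy(4), of i] feq[OF that] lt
          by (simp add: forward_labelling_def)
        then have digits: "j w x div ?p ^ i mod ?p = j w y div ?p ^ i mod ?p" if "i < c + 1" for i
          using that by (simp add: g_def)
        have N: "x \<in> N w" "y \<in> N w" using xy lt V by (auto simp: N_def)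
        then have "j w x < ?p ^ (c + 1)" "j w y < ?p ^ (c + 1)" using j[OF wV] by blast+
        then have "j w x = j w y" using digits by (rule eq_if_digits_eq)
        then show ?thesis using j[OF wV] N by (blast dest: inj_onD)
      qed
      with w(1) show ?thesis by blast
    qed
  qed
  have "acyclic_coloring G (k\<^sup>2 + ?K) col"
    unfolding acyclic_coloring_def
    using col_lt proper undirected_forestI[OF G leaf] by (auto simp del: power_Suc)
  then show ?thesis
    unfolding acyclic_chromatic_def by (blast intro: Least_le)
qed

text \<open>For \<open>k < p\<close> the double logarithm is negative, but
  \<open>p < 2 ^ p \<le> k ^ p\<close> gives \<open>log p k > 1 / p\<close> and keeps it above -1,
  so its ceiling is at least 0 and \<open>nat\<close> loses nothing.\<close>

lemma log_log_bounds:
  fixes p k :: nat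
  assumes p: "2 \<le> p" and k: "2 \<le> k"
  shows "0 \<le> \<lceil>log p (log p k)\<rceil>" "k \<le> p ^ (p ^ nat \<lceil>log p (log p k)\<rceil>)"
proof -
  let ?c = "\<lceil>log p (log p k)\<rceil>"
  have "real p < real (2 ^ p)" by (simp add: of_nat_less_two_power)
  also have "\<dots> \<le> real (k ^ p)" using k by (simp add: power_mono)
  finally have "1 < log p (real k ^ p)" using p k by (simp add: less_log_iff)
  then have "1 < p * log p k" using p k by (simp add: log_nat_power)
  then have "1 / p < log p k" using p by (simp add: divide_simps mult.commute)
  then have "log p (1 / p) < log p (log p k)" using p k by (intro log_less) auto
  then have "- 1 < log p (log p k)" using p by (simp add: log_divide)
  then show c: "0 \<le> ?c" by simp
  have pos: "0 < log p k" using p k by simp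
  have "log p (log p k) \<le> real (nat ?c)" using c by (simp add: of_nat_nat)
  then have "log p k \<le> p powr (nat ?c)" using p pos by (simp add: log_le_iff)
  then have "log p k \<le> real (p ^ nat ?c)" using p by (simp add: powr_realpow)
  then have "k \<le> p powr (p ^ nat ?c)" using p k by (simp add: log_le_iff)
  then have "real k \<le> real (p ^ (p ^ nat ?c))" using p by (simp add: powr_realpow flip: of_nat_power)
  then show "k \<le> p ^ (p ^ nat ?c)" by (simp only: of_nat_le_iff)
qed

theorem theorem2p4:
  fixes n m k :: nat and G :: "'a pair_pre_digraph"
  assumes "2 * n + m \<ge> 1" and "(n, m) \<noteq> (0, 1)"
    and "pair_graph G"
    and "nm_chromatic_simple n m G = k" and "k \<ge> 4"
  shows "real (acyclic_chromatic G) \<le>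
    real k ^ 2 + real k powi (2 + \<lceil>log (real (2 * n + m)) (log (real (2 * n + m)) (real k))\<rceil>)"
proof -
  let ?c = "\<lceil>log (real (2 * n + m)) (log (real (2 * n + m)) (real k))\<rceil>"
  \<comment> \<open>Excluding \<open>(0, 1)\<close> leaves a base of at least 2, as the logarithms
    and the digits require.\<close>
  have p: "2 \<le> 2 * n + m" using assms(1,2) by (cases n) auto
  have k: "2 \<le> k" "1 \<le> k" using assms(5) by auto
  note c = log_log_bounds[OF p k(1)]
  have nat_c: "nat (2 + ?c) = nat ?c + 2" using c(1) by (simp only: nat_add_distrib)
  have "acyclic_chromatic G \<le> k\<^sup>2 + k ^ (nat ?c + 1)"
    by (rule acyclic_chromatic_le[OF assms(3,4) p k(2) c(2)])
  \<comment> \<open>The coloring gives an exponent one below the claimed one.\<close>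
  also have "\<dots> \<le> k\<^sup>2 + k ^ nat (2 + ?c)"
    unfolding nat_c using k(2) by (intro add_left_mono power_increasing) simp_all
  finally have "real (acyclic_chromatic G) \<le> real (k\<^sup>2 + k ^ nat (2 + ?c))"
    by (simp only: of_nat_le_iff)
  then show ?thesis using c(1) by (simp add: power_int_def)
qed

end
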